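(* Let $\mathcal{K}(\mathbb{E}_2)\cong\mathbb{R}^6$ be the space of Killing $2$-tensors of the Euclidean plane with coordinates $(A,B,C,\alpha,\beta,\gamma)$, let $\Delta_E$ be the distribution spanned by $V_1,\dots,V_6$, let $G_E$ be the web-type preserving group, and let $S_1,S_2$ be the subsets defined in the context. On $S_1\setminus S_2$ the rank of the distribution $\Delta_E$ is $5$, and $S_1\setminus S_2$ is an orbit of the action of $G_E$ on $\mathcal{K}(\mathbb{E}_2)$.
   Context: In the Euclidean plane $\mathbb{E}_2$ with Cartesian coordinates $(x,y)$ and standard metric $\mathbf{g}$, the general Killing $2$-tensor has contravariant components $K^{11}=A+2\alpha y+\gamma y^2$, $K^{12}=K^{21}=C-\alpha x-\beta y-\gamma xy$, $K^{22}=B+2\beta x+\gamma x^2$, with $A,B,C,\alpha,\beta,\gamma\in\mathbb{R}$. So the vector space $\mathcal{K}(\mathbb{E}_2)$ of Killing $2$-tensors is identified with $\mathbb{R}^6$ with coordinates $(A,B,C,\alpha,\beta,\gamma)$. With respect to $(\partial_A,\partial_B,\partial_C,\partial_\alpha,\partial_\beta,\partial_\gamma)$ define the following vector fields on $\mathcal{K}(\mathbb{E}_2)$, generating the transformations which preserve the type of the web: $V_1=(0,-2\beta,\alpha,0,-\gamma,0)$ and $V_2=(-2\alpha,0,\beta,-\gamma,0,0)$ (translations); $V_3=(-2C,2C,A-B,\beta,-\alpha,0)$ (rotation); $V_4=(2A,2B,2C,\alpha,\beta,0)$ (dilatation of the plane); $V_5=(1,1,0,0,0,0)$ (addition of a multiple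 of the metric, $\mathbf{K}\mapsto\mathbf{K}+\tau\mathbf{g}$); $V_6=(A,B,C,\alpha,\beta,\gamma)$ (scalar multiplication, $\mathbf{K}\mapsto\lambda\mathbf{K}$). $\Delta_E$ is the distribution spanned by $V_1,\dots,V_6$; its rank at a point is the dimension of the span of the values of $V_1,\dots,V_6$ at that point. $G_E$ is the group of transformations of $\mathcal{K}(\mathbb{E}_2)$ generated by the flows of $V_1,\dots,V_6$ together with the change of sign $\mathbf{K}\mapsto-\mathbf{K}$. $S_1=\{\gamma=0\}$; $S_2=\{\alpha^2-\beta^2=\gamma(A-B),\ \alpha\beta=-\gamma C\}$. *)

theory Defs
  imports
    "HOL-Analysis.Analysis"
    "HOL-Algebra.Group_Action"
    "HOL-Algebra.Generated_Groups"
begin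

section \<open>Killing 2-tensors of the Euclidean plane\<close>

text \<open>A tuple \<open>(A, B, C, \<alpha>, \<beta>, \<gamma>)\<close> of Killing coordinates; the tensor field it stands for is
  \<open>killing_tensor\<close> below.\<close>

type_synonym killing = "real \<times> real \<times> real \<times> real \<times> real \<times> real"

text \<open>Contravariant Cartesian components \<open>(K\<^sup>1\<^sup>1, K\<^sup>1\<^sup>2, K\<^sup>2\<^sup>1, K\<^sup>2\<^sup>2)\<close> at the point \<open>(x, y)\<close>.\<close>

fun killing_tensor :: "killing \<Rightarrow> real \<times> real \<Rightarrow> real \<times> real \<times> real \<times> real" where
  "killing_tensor (A, B, C, \<alpha>, \<beta>, \<gamma>) (x, y) =
    (A + 2 * \<alpha> * y + \<gamma> * y\<^sup>2,
     C - \<alpha> * x - \<beta> * y - \<gamma> * x * y,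
     C - \<alpha> * x - \<beta> * y - \<gamma> * x * y,
     B + 2 * \<beta> * x + \<gamma> * x\<^sup>2)"

lemma inj_killing_tensor: "inj killing_tensor"
proof (rule injI)
  fix K L assume eq: "killing_tensor K = killing_tensor L"
  obtain A B C \<alpha> \<beta> \<gamma> where K: "K = (A, B, C, \<alpha>, \<beta>, \<gamma>)" by (metis prod.exhaust)
  obtain A' B' C' \<alpha>' \<beta>' \<gamma>' where L: "L = (A', B', C', \<alpha>', \<beta>', \<gamma>')" by (metis prod.exhaust)
  show "K = L"
    using fun_cong[OF eq, of "(0, 0)"] fun_cong[OF eq, of "(1, 0)"] fun_cong[OF eq, of "(0, 1)"]
    by (simp add: K L)
qed


section \<open>The distribution \<open>\<Delta>\<^sub>E\<close>\<close>

fun V1 :: "killing \<Rightarrow> killing" where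
  "V1 (A, B, C, \<alpha>, \<beta>, \<gamma>) = (0, - 2 * \<beta>, \<alpha>, 0, - \<gamma>, 0)"

fun V2 :: "killing \<Rightarrow> killing" where
  "V2 (A, B, C, \<alpha>, \<beta>, \<gamma>) = (- 2 * \<alpha>, 0, \<beta>, - \<gamma>, 0, 0)"

fun V3 :: "killing \<Rightarrow> killing" where
  "V3 (A, B, C, \<alpha>, \<beta>, \<gamma>) = (- 2 * C, 2 * C, A - B, \<beta>, - \<alpha>, 0)"

fun V4 :: "killing \<Rightarrow> killing" where
  "V4 (A, B, C, \<alpha>, \<beta>, \<gamma>) = (2 * A, 2 * B, 2 * C, \<alpha>, \<beta>, 0)"

fun V5 :: "killing \<Rightarrow> killing" where
  "V5 (A, B, C, \<alpha>, \<beta>, \<gamma>) = (1, 1, 0, 0, 0, 0)"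

fun V6 :: "killing \<Rightarrow> killing" where
  "V6 (A, B, C, \<alpha>, \<beta>, \<gamma>) = (A, B, C, \<alpha>, \<beta>, \<gamma>)"

definition web_fields :: "(killing \<Rightarrow> killing) set" where
  "web_fields = {V1, V2, V3, V4, V5, V6}"

definition Delta_E :: "killing \<Rightarrow> killing set" where
  "Delta_E K = span {V K | V. V \<in> web_fields}"


section \<open>The web-type preserving group \<open>G\<^sub>E\<close>\<close>

text \<open>The fields above are affine, so their flows are complete; hence only global flows are
  considered.\<close>

definition is_flow :: "('a::real_normed_vector \<Rightarrow> 'a) \<Rightarrow> (real \<Rightarrow> 'a \<Rightarrow> 'a) \<Rightarrow> bool" where
  "is_flow V \<phi> \<longleftrightarrow>
    (\<forall>p. \<phi> 0 p = p \<and> (\<forall>t. ((\<lambda>s. \<phi> s p) has_vector_derivative V (\<phi> t p)) (at t)))"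

definition web_generators :: "(killing \<Rightarrow> killing) set" where
  "web_generators = {\<phi> t | \<phi> t. \<exists>V\<in>web_fields. is_flow V \<phi>} \<union> {uminus}"

definition G_E :: "(killing \<Rightarrow> killing) monoid" where
  "G_E = subgroup_generated (BijGroup UNIV) web_generators"

lemma group_action_G_E: "group_action G_E UNIV (\<lambda>g. g)"
proof (rule group_action.intro)
  interpret B: group "BijGroup (UNIV :: killing set)" by (rule group_BijGroup)
  show "group_hom G_E (BijGroup UNIV) (\<lambda>g. g)"
    unfolding G_E_def
    by (intro group_hom.intro group_hom_axioms.intro B.group_subgroup_generated B.group_axioms)
       (auto simp: hom_def intro: B.carrier_subgroup_generated_subset[THEN subsetD])
qed


section \<open>The invariant subsets\<close>

definition S1 :: "killing set" where
  "S1 = {(A, B, C, \<alpha>, \<beta>, \<gamma>). \<gamma> = 0}"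

definition S2 :: "killing set" where
  "S2 = {(A, B, C, \<alpha>, \<beta>, \<gamma>). \<alpha>\<^sup>2 - \<beta>\<^sup>2 = \<gamma> * (A - B) \<and> \<alpha> * \<beta> = - \<gamma> * C}"

end

theory Submission
  imports Defs
begin

text \<open>On the hyperplane \<open>\<gamma> = 0\<close> the equations of \<open>S2\<close> reduce to \<open>\<alpha> = \<beta> = 0\<close>, so
  \<open>S1 - S2\<close> is the set of tensors with \<open>\<gamma> = 0\<close> and \<open>\<alpha>\<^sup>2 + \<beta>\<^sup>2 \<noteq> 0\<close>
  (\<open>mem_S1_diff_S2_iff\<close>). There all six fields are tangent to \<open>\<gamma> = 0\<close>. The dilatation and the
  rotation move \<open>(\<alpha>, \<beta>)\<close> in two orthogonal directions, and the two translations together with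
  the addition of the metric produce every direction in \<open>(A, B, C)\<close>: the determinant of these
  three is \<open>- 2 (\<alpha>\<^sup>2 + \<beta>\<^sup>2)\<close> (\<open>translations_and_metric_span\<close>). Hence the distribution is the
  whole hyperplane \<open>\<gamma> = 0\<close>, of dimension five.

  Along any integral curve of a generating field, \<open>\<gamma>\<close> solves a homogeneous scalar linear
  equation, and so does \<open>\<alpha>\<^sup>2 + \<beta>\<^sup>2\<close> as soon as \<open>\<gamma>\<close> vanishes. Both are therefore multiplied
  by exponentials, and the group preserves \<open>S1 - S2\<close> (\<open>G_E_preserves_S1_diff_S2\<close>). Conversely,
  rotation and scaling carry \<open>(0, 0, 0, 1, 0, 0)\<close> to any \<open>(0, 0, 0, \<alpha>, \<beta>, 0)\<close> with
  \<open>(\<alpha>, \<beta>) \<noteq> 0\<close>. On \<open>\<gamma> = 0\<close> the flows of \<open>V1\<close>, \<open>V2\<close> and \<open>V5\<close> are translations in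
  \<open>(A, B, C)\<close> along the three vectors above, so they reach every remaining value of
  \<open>(A, B, C)\<close> (\<open>orbit_reaches_S1_diff_S2\<close>).\<close>

section \<open>Coordinates on \<open>S1 - S2\<close>\<close>

fun gamma_coord :: "killing \<Rightarrow> real" where
  "gamma_coord (A, B, C, \<alpha>, \<beta>, \<gamma>) = \<gamma>"

fun alpha_beta_norm :: "killing \<Rightarrow> real" where
  "alpha_beta_norm (A, B, C, \<alpha>, \<beta>, \<gamma>) = \<alpha>\<^sup>2 + \<beta>\<^sup>2"

lemma mem_S1_diff_S2_iff:
  "K \<in> S1 - S2 \<longleftrightarrow> gamma_coord K = 0 \<and> alpha_beta_norm K \<noteq> 0"
  by (cases K rule: gamma_coord.cases)
     (auto simp: S1_def S2_def sum_power2_eq_zero_iff)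

text \<open>Infinitesimally this says that \<open>V1\<close>, \<open>V2\<close>, \<open>V5\<close> span the \<open>(A, B, C)\<close> directions when
  \<open>\<gamma> = 0\<close>; since their flows are then translations along these vectors, it also
  provides the flow times needed for transitivity. The coefficients come from Cramer's rule.\<close>

lemma translations_and_metric_span:
  fixes a b c \<alpha> \<beta> :: real
  assumes "\<alpha>\<^sup>2 + \<beta>\<^sup>2 \<noteq> 0"
  obtains t1 t2 t5
  where "a = t5 - 2 * \<alpha> * t2" "b = t5 - 2 * \<beta> * t1" "c = \<alpha> * t1 + \<beta> * t2"
proof -
  define r where "r = \<alpha>\<^sup>2 + \<beta>\<^sup>2"
  define t1 where "t1 = (\<alpha> * c + \<beta> * (a - b) / 2) / r"
  define t2 where "t2 = (\<beta> * c - \<alpha> * (a - b) / 2) / r"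
  have r: "r \<noteq> 0" using assms by (simp add: r_def)
  have "\<alpha> * t1 + \<beta> * t2 = r * c / r"
    unfolding t1_def t2_def
    by (simp add: r_def add_divide_distrib [symmetric] power2_eq_square algebra_simps)
  moreover have "2 * \<beta> * t1 - 2 * \<alpha> * t2 = r * (a - b) / r"
    unfolding t1_def t2_def
    by (simp add: r_def diff_divide_distrib [symmetric] power2_eq_square algebra_simps)
       (simp add: field_simps)
  ultimately show thesis
    using r by (intro that[of "a + 2 * \<alpha> * t2" t2 t1]) auto
qed


section \<open>The rank of the distribution\<close>

lemma gamma_coord_eq_inner: "gamma_coord K = (0, 0, 0, 0, 0, 1) \<bullet> K"
  by (cases K rule: gamma_coord.cases) simp

lemma Delta_E_on_S1_diff_S2:
  assumes "K \<in> S1 - S2"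
  shows "Delta_E K = {L. gamma_coord L = 0}"
proof
  obtain A B C \<alpha> \<beta> where K: "K = (A, B, C, \<alpha>, \<beta>, 0)" and r: "\<alpha>\<^sup>2 + \<beta>\<^sup>2 \<noteq> 0"
    using assms unfolding mem_S1_diff_S2_iff by (cases K rule: gamma_coord.cases) auto
  have "{V K | V. V \<in> web_fields} \<subseteq> {L. gamma_coord L = 0}"
    by (auto simp: web_fields_def K)
  moreover have "subspace {L. gamma_coord L = 0}"
    unfolding gamma_coord_eq_inner by (rule subspace_hyperplane)
  ultimately show "Delta_E K \<subseteq> {L. gamma_coord L = 0}"
    unfolding Delta_E_def by (rule span_minimal)
  have V: "V K \<in> Delta_E K" if "V \<in> web_fields" for V
    unfolding Delta_E_def using that by (intro span_base) auto
  show "{L. gamma_coord L = 0} \<subseteq> Delta_E K"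
  proof
    fix L assume "L \<in> {L. gamma_coord L = 0}"
    then obtain a b c d e where L: "L = (a, b, c, d, e, 0)"
      by (cases L rule: gamma_coord.cases) auto
    \<comment> \<open>coordinates of \<open>(d, e)\<close> in the orthogonal basis \<open>(\<beta>, - \<alpha>)\<close>, \<open>(\<alpha>, \<beta>)\<close>\<close>
    define x3 where "x3 = (d * \<beta> - e * \<alpha>) / (\<alpha>\<^sup>2 + \<beta>\<^sup>2)"
    define x4 where "x4 = (d * \<alpha> + e * \<beta>) / (\<alpha>\<^sup>2 + \<beta>\<^sup>2)"
    have d: "x3 * \<beta> + x4 * \<alpha> = d"
    proof -
      have "x3 * \<beta> + x4 * \<alpha> = d * (\<alpha>\<^sup>2 + \<beta>\<^sup>2) / (\<alpha>\<^sup>2 + \<beta>\<^sup>2)"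
        unfolding x3_def x4_def
        by (simp add: add_divide_distrib [symmetric] power2_eq_square algebra_simps)
      then show ?thesis using r nonzero_mult_div_cancel_right by metis
    qed
    have e: "x4 * \<beta> - x3 * \<alpha> = e"
    proof -
      have "x4 * \<beta> - x3 * \<alpha> = e * (\<alpha>\<^sup>2 + \<beta>\<^sup>2) / (\<alpha>\<^sup>2 + \<beta>\<^sup>2)"
        unfolding x3_def x4_def
        by (simp add: diff_divide_distrib [symmetric] power2_eq_square algebra_simps)
      then show ?thesis using r nonzero_mult_div_cancel_right by metis
    qed
    obtain x1 x2 x5 where
      "a + 2 * C * x3 - 2 * A * x4 = x5 - 2 * \<alpha> * x2"
      "b - 2 * C * x3 - 2 * B * x4 = x5 - 2 * \<beta> * x1"
      "c - (A - B) * x3 - 2 * C * x4 = \<alpha> * x1 + \<beta> * x2"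
      using translations_and_metric_span[OF r] by metis
    then have "L = x1 *\<^sub>R V1 K + x2 *\<^sub>R V2 K + x3 *\<^sub>R V3 K + x4 *\<^sub>R V4 K + x5 *\<^sub>R V5 K"
      using d e by (simp add: K L algebra_simps)
    also have "\<dots> \<in> Delta_E K"
      using V unfolding web_fields_def Delta_E_def
      by (intro span_add span_scale) auto
    finally show "L \<in> Delta_E K" .
  qed
qed

lemma dim_Delta_E_on_S1_diff_S2:
  assumes "K \<in> S1 - S2"
  shows "dim (Delta_E K) = 5"
proof -
  have "dim {L. gamma_coord L = 0} = DIM(killing) - 1"
    unfolding gamma_coord_eq_inner by (rule dim_hyperplane) (simp add: zero_prod_def)
  then show ?thesis by (simp add: Delta_E_on_S1_diff_S2[OF assms])
qed


section \<open>Invariance of \<open>S1 - S2\<close>\<close>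

lemma linear_ode_solution:
  fixes f :: "real \<Rightarrow> real"
  assumes "\<And>t. (f has_real_derivative k * f t) (at t)"
  shows "f t = f 0 * exp (k * t)"
proof -
  have "((\<lambda>t. f t * exp (- k * t)) has_real_derivative 0) (at t)" for t
    by (auto intro!: derivative_eq_intros assms)
  then have "f t * exp (- k * t) = f 0 * exp (- k * 0)"
    by (intro DERIV_isconst_all) auto
  then show ?thesis by (simp add: exp_minus field_simps)
qed

text \<open>These two identities turn into scalar linear equations for \<open>\<gamma>\<close> and, on \<open>\<gamma> = 0\<close>, for
  \<open>\<alpha>\<^sup>2 + \<beta>\<^sup>2\<close> along integral curves. The value \<open>c\<close> is \<open>1\<close> for scalar multiplication and \<open>0\<close> otherwise; \<open>k\<close> is \<open>1\<close> for
  the dilatation and for scalar multiplication, and \<open>0\<close> otherwise.\<close>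

lemma web_field_weights:
  assumes "V \<in> web_fields"
  obtains c k where
    "\<And>A B C \<alpha> \<beta> \<gamma>. gamma_coord (V (A, B, C, \<alpha>, \<beta>, \<gamma>)) = c * \<gamma>"
    "\<And>A B C \<alpha> \<beta>. \<exists>A' B' C' \<alpha>' \<beta>' \<gamma>'. V (A, B, C, \<alpha>, \<beta>, 0) = (A', B', C', \<alpha>', \<beta>', \<gamma>') \<and>
       \<alpha> * \<alpha>' + \<beta> * \<beta>' = k * (\<alpha>\<^sup>2 + \<beta>\<^sup>2)"
proof -
  consider "V \<in> {V1, V2, V3, V5}" | "V = V4" | "V = V6"
    using assms by (auto simp: web_fields_def)
  then show thesis
  proof cases
    case 1 then show thesis by (intro that[of 0 0]) auto
  next
    case 2 then show thesis by (intro that[of 0 1]) (auto simp: power2_eq_square)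
  next
    case 3 then show thesis by (intro that[of 1 1]) (auto simp: power2_eq_square)
  qed
qed

text \<open>Only the defining differential equation is used, so this covers every map that counts as a
  flow, not just the closed formulas below. The equivalence makes inverses of
  flow maps preserve the set as well.\<close>

lemma flow_mem_S1_diff_S2_iff:
  assumes "V \<in> web_fields" and flow: "is_flow V \<phi>"
  shows "\<phi> t K \<in> S1 - S2 \<longleftrightarrow> K \<in> S1 - S2"
proof -
  obtain c k where
    c: "\<And>A B C \<alpha> \<beta> \<gamma>. gamma_coord (V (A, B, C, \<alpha>, \<beta>, \<gamma>)) = c * \<gamma>" and
    k: "\<And>A B C \<alpha> \<beta>. \<exists>A' B' C' \<alpha>' \<beta>' \<gamma>'. V (A, B, C, \<alpha>, \<beta>, 0) = (A', B', C', \<alpha>', \<beta>', \<gamma>') \<and>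
       \<alpha> * \<alpha>' + \<beta> * \<beta>' = k * (\<alpha>\<^sup>2 + \<beta>\<^sup>2)"
    using web_field_weights[OF assms(1)] by metis
  have D: "((\<lambda>s. \<phi> s K) has_vector_derivative V (\<phi> t K)) (at t)" and init: "\<phi> 0 K = K" for t
    using flow unfolding is_flow_def by blast+
  have "((\<lambda>s. gamma_coord (\<phi> s K)) has_real_derivative c * gamma_coord (\<phi> t K)) (at t)" for t
  proof -
    have "((\<lambda>s. gamma_coord (\<phi> s K)) has_vector_derivative gamma_coord (V (\<phi> t K))) (at t)"
      unfolding gamma_coord_eq_inner
      by (rule bounded_linear.has_vector_derivative[OF bounded_linear_inner_right D])
    moreover have "gamma_coord (V (\<phi> t K)) = c * gamma_coord (\<phi> t K)"
      by (cases "\<phi> t K" rule: gamma_coord.cases) (simp add: c)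
    ultimately show ?thesis by (simp add: has_real_derivative_iff_has_vector_derivative)
  qed
  from linear_ode_solution[OF this]
  have gamma: "gamma_coord (\<phi> t K) = gamma_coord K * exp (c * t)" for t
    by (simp add: init)
  have norm: "alpha_beta_norm (\<phi> t K) = alpha_beta_norm K * exp (2 * k * t)"
    if zero: "gamma_coord K = 0" for t
  proof -
    define f where "f = (\<lambda>s. alpha_beta_norm (\<phi> s K))"
    have "(f has_real_derivative (2 * k) * f t) (at t)" for t
    proof -
      obtain A B C \<alpha> \<beta> where P: "\<phi> t K = (A, B, C, \<alpha>, \<beta>, 0)"
        using gamma[of t] zero by (cases "\<phi> t K" rule: gamma_coord.cases) auto
      obtain A' B' C' \<alpha>' \<beta>' \<gamma>' where V: "V (\<phi> t K) = (A', B', C', \<alpha>', \<beta>', \<gamma>')"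
        and eq: "\<alpha> * \<alpha>' + \<beta> * \<beta>' = k * (\<alpha>\<^sup>2 + \<beta>\<^sup>2)"
        using k[of A B C \<alpha> \<beta>] P by auto
      have inner: "((\<lambda>s. L \<bullet> \<phi> s K) has_real_derivative L \<bullet> V (\<phi> t K)) (at t)" for L
        unfolding has_real_derivative_iff_has_vector_derivative
        by (rule bounded_linear.has_vector_derivative[OF bounded_linear_inner_right D])
      let ?a = "(0, 0, 0, 1, 0, 0) :: killing" and ?b = "(0, 0, 0, 0, 1, 0) :: killing"
      have f: "f = (\<lambda>s. (?a \<bullet> \<phi> s K)\<^sup>2 + (?b \<bullet> \<phi> s K)\<^sup>2)"
      proof
        show "f s = (?a \<bullet> \<phi> s K)\<^sup>2 + (?b \<bullet> \<phi> s K)\<^sup>2" for s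
          by (cases "\<phi> s K" rule: gamma_coord.cases) (simp add: f_def)
      qed
      have "(f has_real_derivative 2 * \<alpha> * \<alpha>' + 2 * \<beta> * \<beta>') (at t)"
        unfolding f by (auto intro!: derivative_eq_intros inner simp: P V[unfolded P])
      moreover have "2 * \<alpha> * \<alpha>' + 2 * \<beta> * \<beta>' = (2 * k) * f t"
        using eq by (simp add: f_def P)
      ultimately show ?thesis by simp
    qed
    from linear_ode_solution[OF this, of t] show ?thesis by (simp add: f_def init)
  qed
  show ?thesis
    unfolding mem_S1_diff_S2_iff using gamma norm by auto
qed

lemma web_generator_mem_S1_diff_S2_iff:
  assumes "g \<in> web_generators"
  shows "g K \<in> S1 - S2 \<longleftrightarrow> K \<in> S1 - S2"
proof -
  have "- K \<in> S1 - S2 \<longleftrightarrow> K \<in> S1 - S2"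
    unfolding mem_S1_diff_S2_iff by (cases K rule: gamma_coord.cases) simp
  moreover consider "g = uminus" | V \<phi> t where "V \<in> web_fields" "is_flow V \<phi>" "g = \<phi> t"
    using assms unfolding web_generators_def by blast
  ultimately show ?thesis
    using flow_mem_S1_diff_S2_iff by metis
qed

lemma carrier_G_E:
  "carrier G_E = generate (BijGroup UNIV) (carrier (BijGroup UNIV) \<inter> web_generators)"
  by (simp add: G_E_def carrier_subgroup_generated)

lemma mult_BijGroup_UNIV:
  assumes "g \<in> carrier (BijGroup UNIV)" "h \<in> carrier (BijGroup UNIV)"
  shows "g \<otimes>\<^bsub>BijGroup UNIV\<^esub> h = g \<circ> h"
  using assms by (auto simp: BijGroup_def compose_def fun_eq_iff)

lemma G_E_preserves_S1_diff_S2: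
  assumes "g \<in> carrier G_E"
  shows "g K \<in> S1 - S2 \<longleftrightarrow> K \<in> S1 - S2"
proof -
  interpret B: group "BijGroup (UNIV :: killing set)" by (rule group_BijGroup)
  have sub: "generate (BijGroup UNIV) (carrier (BijGroup UNIV) \<inter> web_generators)
      \<subseteq> carrier (BijGroup UNIV)"
    by (rule B.generate_incl) simp
  show ?thesis
    using assms unfolding carrier_G_E
  proof (induction arbitrary: K rule: generate.induct)
    case one
    then show ?case by (simp add: BijGroup_def)
  next
    case (incl h)
    then show ?case using web_generator_mem_S1_diff_S2_iff by blast
  next
    case (inv h)
    let ?i = "inv\<^bsub>BijGroup UNIV\<^esub> h"
    have h: "h \<in> carrier (BijGroup UNIV)" "h \<in> web_generators" using inv by auto
    have "h \<circ> ?i = \<one>\<^bsub>BijGroup UNIV\<^esub>"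
      using h B.r_inv mult_BijGroup_UNIV B.inv_closed by metis
    then have "(h \<circ> ?i) K = K" by (simp only:) (simp add: BijGroup_def)
    then have "h (?i K) = K" by (simp only: o_apply)
    then show ?case using web_generator_mem_S1_diff_S2_iff[OF h(2), of "?i K"] by simp
  next
    case (eng h1 h2)
    then show ?case using sub by (simp add: mult_BijGroup_UNIV subset_iff)
  qed
qed


section \<open>Transitivity on \<open>S1 - S2\<close>\<close>

lemma comp_mem_G_E:
  assumes "g \<in> carrier G_E" "h \<in> carrier G_E"
  shows "g \<circ> h \<in> carrier G_E"
proof -
  interpret B: group "BijGroup (UNIV :: killing set)" by (rule group_BijGroup)
  have "generate (BijGroup UNIV) (carrier (BijGroup UNIV) \<inter> web_generators)
      \<subseteq> carrier (BijGroup UNIV)"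
    by (rule B.generate_incl) simp
  then show ?thesis
    using assms generate.eng[of g "BijGroup UNIV" _ h] mult_BijGroup_UNIV[of g h]
    unfolding carrier_G_E by (auto simp: subset_iff)
qed

lemma flow_mem_G_E:
  assumes "V \<in> web_fields" "is_flow V \<phi>"
    and inverse: "\<And>t p. \<phi> t (\<phi> (- t) p) = p"
  shows "\<phi> t \<in> carrier G_E"
proof -
  have "bij (\<phi> t)"
    by (rule o_bij[of "\<phi> (- t)"]) (use inverse[of "- t"] inverse[of t] in \<open>auto simp: fun_eq_iff\<close>)
  then have "\<phi> t \<in> carrier (BijGroup UNIV)" by (simp add: BijGroup_def Bij_def)
  moreover have "\<phi> t \<in> web_generators" using assms by (auto simp: web_generators_def)
  ultimately show ?thesis unfolding carrier_G_E by (auto intro: generate.incl)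
qed

fun flow1 :: "real \<Rightarrow> killing \<Rightarrow> killing" where
  "flow1 t (A, B, C, \<alpha>, \<beta>, \<gamma>) = (A, B - 2 * \<beta> * t + \<gamma> * t\<^sup>2, C + \<alpha> * t, \<alpha>, \<beta> - \<gamma> * t, \<gamma>)"

fun flow2 :: "real \<Rightarrow> killing \<Rightarrow> killing" where
  "flow2 t (A, B, C, \<alpha>, \<beta>, \<gamma>) = (A - 2 * \<alpha> * t + \<gamma> * t\<^sup>2, B, C + \<beta> * t, \<alpha> - \<gamma> * t, \<beta>, \<gamma>)"

text \<open>The rotation fixes \<open>A + B\<close>, and it turns \<open>(\<alpha>, \<beta>)\<close> with angular speed \<open>1\<close> and
  \<open>((A - B) / 2, C)\<close> with angular speed \<open>2\<close>.\<close>

fun flow3 :: "real \<Rightarrow> killing \<Rightarrow> killing" where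
  "flow3 t (A, B, C, \<alpha>, \<beta>, \<gamma>) =
    ((A + B) / 2 + ((A - B) / 2 * cos (2 * t) - C * sin (2 * t)),
     (A + B) / 2 - ((A - B) / 2 * cos (2 * t) - C * sin (2 * t)),
     C * cos (2 * t) + (A - B) / 2 * sin (2 * t),
     \<alpha> * cos t + \<beta> * sin t, \<beta> * cos t - \<alpha> * sin t, \<gamma>)"

fun flow5 :: "real \<Rightarrow> killing \<Rightarrow> killing" where
  "flow5 t (A, B, C, \<alpha>, \<beta>, \<gamma>) = (A + t, B + t, C, \<alpha>, \<beta>, \<gamma>)"

definition flow6 :: "real \<Rightarrow> killing \<Rightarrow> killing" where
  "flow6 t K = exp t *\<^sub>R K"

lemma is_flowI:
  assumes "\<And>A B C \<alpha> \<beta> \<gamma>. \<phi> 0 (A, B, C, \<alpha>, \<beta>, \<gamma>) = (A, B, C, \<alpha>, \<beta>, \<gamma>)"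
    and "\<And>t A B C \<alpha> \<beta> \<gamma>. ((\<lambda>s. \<phi> s (A, B, C, \<alpha>, \<beta>, \<gamma>))
      has_vector_derivative V (\<phi> t (A, B, C, \<alpha>, \<beta>, \<gamma>))) (at t)"
  shows "is_flow V \<phi>"
  using assms by (auto simp: is_flow_def)

lemma flow1_mem_G_E: "flow1 t \<in> carrier G_E"
proof (rule flow_mem_G_E)
  show "is_flow V1 flow1"
    by (rule is_flowI)
       (auto intro!: has_vector_derivative_Pair derivative_eq_intros
         simp: zero_prod_def simp flip: has_real_derivative_iff_has_vector_derivative)
  show "flow1 t (flow1 (- t) p) = p" for t p
    by (cases p rule: gamma_coord.cases) (simp add: power2_eq_square algebra_simps)
qed (simp add: web_fields_def)

lemma flow2_mem_G_E: "flow2 t \<in> carrier G_E"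
proof (rule flow_mem_G_E)
  show "is_flow V2 flow2"
    by (rule is_flowI)
       (auto intro!: has_vector_derivative_Pair derivative_eq_intros
         simp: zero_prod_def simp flip: has_real_derivative_iff_has_vector_derivative)
  show "flow2 t (flow2 (- t) p) = p" for t p
    by (cases p rule: gamma_coord.cases) (simp add: power2_eq_square algebra_simps)
qed (simp add: web_fields_def)

lemma rotate_back:
  fixes x y t :: real
  shows "(x * cos t - y * sin t) * cos t + (y * cos t + x * sin t) * sin t = x"
    and "(y * cos t + x * sin t) * cos t - (x * cos t - y * sin t) * sin t = y"
  using sin_cos_squared_add[of t] by algebra+

text \<open>In terms of half the sum \<open>s\<close> and half the difference \<open>d\<close> of \<open>A\<close> and \<open>B\<close>, the flow is a
  product of plane rotations, and composing flow maps becomes a computation with \<open>rotate_back\<close>.\<close>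

lemma flow3_half_sum_half_difference:
  "flow3 t (s + d, s - d, C, \<alpha>, \<beta>, \<gamma>) =
    (s + (d * cos (2 * t) - C * sin (2 * t)), s - (d * cos (2 * t) - C * sin (2 * t)),
     C * cos (2 * t) + d * sin (2 * t), \<alpha> * cos t + \<beta> * sin t, \<beta> * cos t - \<alpha> * sin t, \<gamma>)"
proof -
  have "(s + d + (s - d)) / 2 = s" "(s + d - (s - d)) / 2 = d" by simp_all
  then show ?thesis by (simp only: flow3.simps)
qed

lemma flow3_mem_G_E: "flow3 t \<in> carrier G_E"
proof (rule flow_mem_G_E)
  show "is_flow V3 flow3"
    by (rule is_flowI)
       (auto intro!: has_vector_derivative_Pair derivative_eq_intros
         simp: field_simps zero_prod_def simp flip: has_real_derivative_iff_has_vector_derivative)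
  show "flow3 t (flow3 (- t) p) = p" for t p
  proof (cases p rule: gamma_coord.cases)
    case (1 A B C \<alpha> \<beta> \<gamma>)
    define s d where "s = (A + B) / 2" and "d = (A - B) / 2"
    have p: "p = (s + d, s - d, C, \<alpha>, \<beta>, \<gamma>)" by (simp add: 1 s_def d_def field_simps)
    show ?thesis
      using rotate_back[where x = \<alpha> and y = \<beta> and t = t]
        rotate_back[where x = C and y = d and t = "2 * t"]
      unfolding p flow3_half_sum_half_difference by simp
  qed
qed (simp add: web_fields_def)

lemma flow5_mem_G_E: "flow5 t \<in> carrier G_E"
proof (rule flow_mem_G_E)
  show "is_flow V5 flow5"
    by (rule is_flowI)
       (auto intro!: has_vector_derivative_Pair derivative_eq_intros
         simp: zero_prod_def simp flip: has_real_derivative_iff_has_vector_derivative)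
  show "flow5 t (flow5 (- t) p) = p" for t p
    by (cases p rule: gamma_coord.cases) simp
qed (simp add: web_fields_def)

lemma flow6_mem_G_E: "flow6 t \<in> carrier G_E"
proof (rule flow_mem_G_E)
  show "is_flow V6 flow6"
    by (rule is_flowI)
       (auto intro!: has_vector_derivative_Pair derivative_eq_intros
         simp: flow6_def zero_prod_def simp flip: has_real_derivative_iff_has_vector_derivative)
  show "flow6 t (flow6 (- t) p) = p" for t p
    by (simp add: flow6_def flip: exp_add)
qed (simp add: web_fields_def)

lemma orbit_reaches_S1_diff_S2:
  assumes "K \<in> S1 - S2"
  shows "\<exists>g\<in>carrier G_E. g (0, 0, 0, 1, 0, 0) = K"
proof -
  obtain A B C \<alpha> \<beta> where K: "K = (A, B, C, \<alpha>, \<beta>, 0)" and r: "\<alpha>\<^sup>2 + \<beta>\<^sup>2 \<noteq> 0"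
    using assms unfolding mem_S1_diff_S2_iff by (cases K rule: gamma_coord.cases) auto
  define \<rho> where "\<rho> = sqrt (\<alpha>\<^sup>2 + \<beta>\<^sup>2)"
  have \<rho>: "\<rho> > 0" "\<rho>\<^sup>2 = \<alpha>\<^sup>2 + \<beta>\<^sup>2"
    using r by (auto simp: \<rho>_def sum_power2_gt_zero_iff)
  have "(\<alpha> / \<rho>)\<^sup>2 + (- \<beta> / \<rho>)\<^sup>2 = 1"
    using \<rho> r by (simp add: power_divide flip: add_divide_distrib)
  \<comment> \<open>the rotation field turns \<open>(\<alpha>, \<beta>)\<close> clockwise, whence the sign of \<open>\<beta>\<close>\<close>
  then obtain \<theta> where "\<alpha> / \<rho> = cos \<theta>" "- \<beta> / \<rho> = sin \<theta>"
    by (rule sincos_total_2pi)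
  then have polar: "\<rho> * cos \<theta> = \<alpha>" "- (\<rho> * sin \<theta>) = \<beta>"
    using \<rho> by (auto simp: field_simps)
  obtain t1 t2 t5 where t: "A = t5 - 2 * \<alpha> * t2" "B = t5 - 2 * \<beta> * t1" "C = \<alpha> * t1 + \<beta> * t2"
    using translations_and_metric_span[OF r] by metis
  have "(flow5 t5 \<circ> (flow2 t2 \<circ> (flow1 t1 \<circ> (flow6 (ln \<rho>) \<circ> flow3 \<theta>)))) (0, 0, 0, 1, 0, 0) = K"
    using \<rho>(1) by (simp add: flow6_def polar K t)
  moreover have "flow5 t5 \<circ> (flow2 t2 \<circ> (flow1 t1 \<circ> (flow6 (ln \<rho>) \<circ> flow3 \<theta>))) \<in> carrier G_E"
    by (intro comp_mem_G_E flow1_mem_G_E flow2_mem_G_E flow3_mem_G_E flow5_mem_G_E flow6_mem_G_E)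
  ultimately show ?thesis by blast
qed

theorem proposition7:
  shows "(\<forall>K \<in> S1 - S2. dim (Delta_E K) = 5) \<and>
         S1 - S2 \<in> orbits G_E UNIV (\<lambda>g. g)"
proof
  show "\<forall>K \<in> S1 - S2. dim (Delta_E K) = 5"
    using dim_Delta_E_on_S1_diff_S2 by blast
  have base: "(0, 0, 0, 1, 0, 0) \<in> S1 - S2"
    unfolding mem_S1_diff_S2_iff by simp
  have "S1 - S2 = orbit G_E (\<lambda>g. g) (0, 0, 0, 1, 0, 0)"
  proof
    show "S1 - S2 \<subseteq> orbit G_E (\<lambda>g. g) (0, 0, 0, 1, 0, 0)"
    proof
      fix K assume "K \<in> S1 - S2"
      from orbit_reaches_S1_diff_S2[OF this]
      show "K \<in> orbit G_E (\<lambda>g. g) (0, 0, 0, 1, 0, 0)" by (auto simp: orbit_def)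
    qed
    show "orbit G_E (\<lambda>g. g) (0, 0, 0, 1, 0, 0) \<subseteq> S1 - S2"
      using base G_E_preserves_S1_diff_S2 by (fastforce simp: orbit_def)
  qed
  then show "S1 - S2 \<in> orbits G_E UNIV (\<lambda>g. g)"
    unfolding orbits_def by blast
qed

end
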